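(* Let $M \in \mathbb{R}^{m\times n}_+$ be a noiseless hyperspectral image with different illumination conditions, with two endmembers, satisfying the linear mixing model and the pure-pixel assumption; that is, $M = \widetilde{W}[I_2, H']\Pi$ where $\widetilde{W} \in \mathbb{R}^{m \times 2}_+$, $I_2$ is the $2 \times 2$ identity matrix, $H' \in \mathbb{R}^{2\times (n-2)}_+$ is such that the entries of each column of $H'$ sum to at most one, and $\Pi$ is an $n \times n$ permutation matrix. Then the rank-two NMF algorithm described in the context, applied to $M$, computes an optimal rank-two NMF of $M$; that is, any pair $(W,H) \in \mathbb{R}^{m\times 2}_+ \times \mathbb{R}^{2 \times n}_+$ output by it satisfies $$\|M-WH\|_F^2 = \min_{P \in \mathbb{R}^{m \times 2},\, P \geq 0,\; Q \in \mathbb{R}^{2 \times n},\, Q \geq 0} \|M-PQ\|_F^2 .$$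
   Context: Inequalities such as $P \ge 0$ between a matrix and zero are entrywise; $\mathbb{R}^{m\times n}_+$ is the set of entrywise nonnegative real $m \times n$ matrices; $\|\cdot\|_F$ is the Frobenius norm. $A(:,j)$ denotes the $j$-th column of $A$. The rank-two NMF algorithm takes as input $M \in \mathbb{R}^{m\times n}_+$ (with $m,n\ge 2$) and proceeds as follows (arbitrary choices are allowed whenever a minimizer, maximizer or SVD is not unique). 1. Compute a rank-two truncated singular value decomposition of $M$: $U \in \mathbb{R}^{m\times 2}$ with orthonormal columns (left singular vectors for the two largest singular values), $S \in \mathbb{R}^{2\times 2}$ diagonal with the two largest singular values $\sigma_1(M)\ge\sigma_2(M)$, and $V \in \mathbb{R}^{2\times n}$ with orthonormal rows (the corresponding right singular vectors), so that $USV$ is a best approximation of $M$ of rank at most two in Frobenius norm. 2. Let $X = SV = U^TM \in \mathbb{R}^{2\times n}$. 3. Extract two column indices $K=(k_1,k_2)$ from $X$ with the successive projection algorithm (SPA): choose $k_1 \in \operatorname{argmax}_j \|X(:,j)\|_2$; set $R = \left(I - \frac{X(:,k_1)X(:,k_1)^T}{\|X(:,k_1)\|_2^2}\right) X$ (with $R = X$ if $X(:,k_1)=0$); choose $k_2 \in \operatorname{argmax}_j \|R(:,j)\|_2$. 4. Let $W = \max(0, USV(:,K)) \in \mathbb{R}^{m \times 2}_+$, where the maximum is entrywise and $V(:,K)$ is the $2\times 2$ matrix with columns $V(:,k_1), V(:,k_2)$. 5. Let $H \in \operatorname{argmin}_{Y \in \mathbb{R}^{2\times n},\, Y \geq 0}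 \|M - WY\|_F^2$. Output $(W,H)$. *)

theory Defs
  imports
    Complex_Main
    "HOL-Combinatorics.Permutations"
    "Jordan_Normal_Form.Matrix"
begin

text \<open>Row and column indices are 0-based throughout.\<close>

definition nonneg_mats :: "nat \<Rightarrow> nat \<Rightarrow> real mat set" where
  "nonneg_mats m n = {A \<in> carrier_mat m n. 0\<^sub>m m n \<le> A}"

definition frob_norm :: "real mat \<Rightarrow> real" where
  "frob_norm A = sqrt (\<Sum>i<dim_row A. \<Sum>j<dim_col A. (A $$ (i, j))\<^sup>2)"

definition l2_norm :: "real vec \<Rightarrow> real" where
  "l2_norm v = sqrt (v \<bullet> v)"

definition append_cols :: "real mat \<Rightarrow> real mat \<Rightarrow> real mat" (infixr \<open>@\<^sub>c\<close> 65) where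
  "A @\<^sub>c B = four_block_mat A B (0\<^sub>m 0 (dim_col A)) (0\<^sub>m 0 (dim_col B))"

definition permutation_mat :: "nat \<Rightarrow> real mat \<Rightarrow> bool" where
  "permutation_mat n P \<longleftrightarrow>
     (\<exists>\<pi>. \<pi> permutes {..<n} \<and> P = mat n n (\<lambda>(i, j). if i = \<pi> j then 1 else 0))"

definition full_svd :: "real mat \<Rightarrow> real mat \<Rightarrow> real mat \<Rightarrow> real mat \<Rightarrow> bool" where
  "full_svd M U \<Sigma> V \<longleftrightarrow>
     (let m = dim_row M; n = dim_col M in
       U \<in> carrier_mat m m \<and> U\<^sup>T * U = 1\<^sub>m m \<and>
       V \<in> carrier_mat n n \<and> V\<^sup>T * V = 1\<^sub>m n \<and>
       \<Sigma> \<in> carrier_mat m n \<and> diagonal_mat \<Sigma> \<and>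
       (\<forall>i<min m n. 0 \<le> \<Sigma> $$ (i, i)) \<and>
       (\<forall>i j. i \<le> j \<longrightarrow> j < min m n \<longrightarrow> \<Sigma> $$ (j, j) \<le> \<Sigma> $$ (i, i)) \<and>
       M = U * \<Sigma> * V\<^sup>T)"

text \<open>A rank-\<open>r\<close> truncated SVD (meant for \<open>r \<le> min m n\<close>) keeps the first \<open>r\<close> singular triples of
  some full SVD. The third factor has the right singular vectors as its rows.\<close>

definition truncated_svd :: "nat \<Rightarrow> real mat \<Rightarrow> real mat \<Rightarrow> real mat \<Rightarrow> real mat \<Rightarrow> bool" where
  "truncated_svd r M U S V \<longleftrightarrow>
     (\<exists>U' \<Sigma> V'. full_svd M U' \<Sigma> V' \<and>
        U = mat (dim_row M) r (\<lambda>(i, j). U' $$ (i, j)) \<and>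
        S = mat r r (\<lambda>(i, j). \<Sigma> $$ (i, j)) \<and>
        V = mat r (dim_col M) (\<lambda>(i, j). V' $$ (j, i)))"

definition spa_residual :: "real mat \<Rightarrow> nat \<Rightarrow> real mat" where
  "spa_residual X k =
     (let d = dim_row X; x = col X k in
      if x = 0\<^sub>v d then X
      else (1\<^sub>m d - (1 / (l2_norm x)\<^sup>2) \<cdot>\<^sub>m (mat_of_cols d [x] * mat_of_rows d [x])) * X)"

definition max_norm_col :: "real mat \<Rightarrow> nat \<Rightarrow> bool" where
  "max_norm_col X k \<longleftrightarrow> is_arg_max (\<lambda>j. l2_norm (col X j)) (\<lambda>j. j < dim_col X) k"

definition spa2 :: "real mat \<Rightarrow> nat \<Rightarrow> nat \<Rightarrow> bool" where
  "spa2 X k1 k2 \<longleftrightarrow> max_norm_col X k1 \<and> max_norm_col (spa_residual X k1) k2"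

text \<open>The algorithm as a relation between input and possible outputs: ties in the SVD, in SPA and
  in the least-squares step may be broken arbitrarily.\<close>

definition rank_two_nmf :: "real mat \<Rightarrow> real mat \<Rightarrow> real mat \<Rightarrow> bool" where
  "rank_two_nmf M W H \<longleftrightarrow>
     (\<exists>U S V k1 k2.
        truncated_svd 2 M U S V \<and>
        spa2 (S * V) k1 k2 \<and>
        W = map_mat (max 0) (U * S * mat_of_cols 2 [col V k1, col V k2]) \<and>
        is_arg_min (\<lambda>Y. (frob_norm (M - W * Y))\<^sup>2) (\<lambda>Y. Y \<in> nonneg_mats 2 (dim_col M)) H)"

end

theory Submission
  imports Defs
begin

text \<open>
  Since \<open>M\<close> has rank at most two, the truncated SVD is exact: \<open>M = U X\<close> with \<open>X = S V = U\<^sup>T M\<close>. The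
  columns of \<open>X\<close> lie in the convex hull of \<open>0\<close> and two of them, \<open>a\<close> and \<open>b\<close>, and have pairwise
  nonnegative inner products because \<open>M\<close> does. A column of maximal norm is \<open>a\<close> or \<open>b\<close> by strict
  convexity, and in the plane the residual norm is proportional to the determinant with that column,
  so SPA finds the other one unless \<open>a\<close> and \<open>b\<close> are parallel. In either case all columns of \<open>X\<close>,
  hence of \<open>M\<close>, are in the cone of the two selected ones; these columns of \<open>M\<close> are already
  nonnegative, so the thresholding leaves them unchanged and the final least-squares residual is zero.
\<close>

section \<open>Exactness of the truncated SVD\<close>

text \<open>The left-hand sides form a \<open>3 \<times> 3\<close> matrix of rank at most two; expand its determinant.\<close>

lemma rank_two_diagonal3:
  fixes c d :: "nat \<Rightarrow> real"
  assumes "\<And>i j. i < 3 \<Longrightarrow> j < 3 \<Longrightarrow> c i * d j + c' i * d' j = (if i = j then s i else 0)"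
  shows "s 0 * s 1 * s 2 = 0"
proof -
  let ?e = "\<lambda>i j. c i * d j + c' i * d' j"
  have "?e 0 0 * (?e 1 1 * ?e 2 2 - ?e 1 2 * ?e 2 1)
      - ?e 0 1 * (?e 1 0 * ?e 2 2 - ?e 1 2 * ?e 2 0)
      + ?e 0 2 * (?e 1 0 * ?e 2 1 - ?e 1 1 * ?e 2 0) = 0"
    by (simp add: algebra_simps)
  then show ?thesis
    by (simp add: assms)
qed

text \<open>Orthogonality of \<open>U\<close> and \<open>V\<close> turns the SVD into
  \<open>\<Sigma> = (U\<^sup>T * A) * (B * V)\<close>, which factors through dimension two. Its
  leading 3 by 3 block is therefore singular, so one of the first three singular values vanishes;
  the decreasing order and nonnegativity then kill every later one.\<close>

lemma full_svd_rank_two: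
  assumes svd: "full_svd M U \<Sigma> V"
    and M: "M = A * B" "A \<in> carrier_mat m 2" "B \<in> carrier_mat 2 n"
    and i: "2 \<le> i" "i < m" "i < n"
  shows "\<Sigma> $$ (i, i) = 0"
proof -
  have dims: "dim_row M = m" "dim_col M = n"
    using M by auto
  have U: "U \<in> carrier_mat m m" "U\<^sup>T * U = 1\<^sub>m m" and V: "V \<in> carrier_mat n n" "V\<^sup>T * V = 1\<^sub>m n"
    and S: "\<Sigma> \<in> carrier_mat m n" "diagonal_mat \<Sigma>" and MS: "M = U * \<Sigma> * V\<^sup>T"
    and nonneg: "\<And>i. i < min m n \<Longrightarrow> 0 \<le> \<Sigma> $$ (i, i)"
    and dec: "\<And>i j. i \<le> j \<Longrightarrow> j < min m n \<Longrightarrow> \<Sigma> $$ (j, j) \<le> \<Sigma> $$ (i, i)"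
    using svd by (auto simp: full_svd_def Let_def dims)
  define C where "C = U\<^sup>T * A"
  define D where "D = B * V"
  have C: "C \<in> carrier_mat m 2" and D: "D \<in> carrier_mat 2 n"
    using U V M by (auto simp: C_def D_def)
  have "C * D = U\<^sup>T * ((A * B) * V)"
    unfolding C_def D_def using U V M
    by (simp add: assoc_mult_mat[of _ m m _ 2 _ n] assoc_mult_mat[of _ m 2 _ n _ n])
  also have "\<dots> = U\<^sup>T * ((U * \<Sigma> * V\<^sup>T) * V)"
    using M MS by simp
  also have "(U * \<Sigma> * V\<^sup>T) * V = U * \<Sigma> * (V\<^sup>T * V)"
    using U S V by (intro assoc_mult_mat) auto
  also have "\<dots> = U * \<Sigma>"
    using U S V by (simp add: right_mult_one_mat[of _ m n])
  also have "U\<^sup>T * (U * \<Sigma>) = (U\<^sup>T * U) * \<Sigma>"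
    using U S by (intro assoc_mult_mat[symmetric]) auto
  also have "\<dots> = \<Sigma>"
    using U S by (simp add: left_mult_one_mat[of _ m n])
  finally have eq: "C * D = \<Sigma>" .
  have ent: "\<Sigma> $$ (k, l) = C $$ (k, 0) * D $$ (0, l) + C $$ (k, 1) * D $$ (1, l)"
    if "k < m" "l < n" for k l
    unfolding eq[symmetric] using that C D by (simp add: scalar_prod_def numeral_2_eq_2)
  have "\<Sigma> $$ (0, 0) * \<Sigma> $$ (1, 1) * \<Sigma> $$ (2, 2) = 0"
  proof (rule rank_two_diagonal3)
    fix k l :: nat
    assume "k < 3" "l < 3"
    then have "k < m" "l < n"
      using i by auto
    then show "C $$ (k, 0) * D $$ (0, l) + C $$ (k, 1) * D $$ (1, l)
        = (if k = l then \<Sigma> $$ (k, k) else 0)"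
      using ent[of k l] S by (auto simp: diagonal_mat_def)
  qed
  moreover have "\<Sigma> $$ (i, i) \<le> \<Sigma> $$ (k, k)" if "k \<le> 2" for k
    using dec[of k i] that i by auto
  from this[of 0] this[of 1] this[of 2]
  have "\<Sigma> $$ (i, i) \<le> \<Sigma> $$ (0, 0)" "\<Sigma> $$ (i, i) \<le> \<Sigma> $$ (1, 1)" "\<Sigma> $$ (i, i) \<le> \<Sigma> $$ (2, 2)"
    by auto
  moreover have "0 \<le> \<Sigma> $$ (i, i)"
    using nonneg i by simp
  ultimately show ?thesis
    by auto
qed

lemma truncated_svd_exact:
  assumes svd: "truncated_svd 2 M U S V"
    and M: "M = A * B" "A \<in> carrier_mat m 2" "B \<in> carrier_mat 2 n"
    and mn: "2 \<le> m" "2 \<le> n"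
  shows "U \<in> carrier_mat m 2" "S \<in> carrier_mat 2 2" "V \<in> carrier_mat 2 n"
    and "U\<^sup>T * U = 1\<^sub>m 2" and "M = U * (S * V)"
proof -
  have dims: "dim_row M = m" "dim_col M = n"
    using M by auto
  obtain U' \<Sigma> V' where full: "full_svd M U' \<Sigma> V'"
    and U: "U = mat m 2 (\<lambda>(i, j). U' $$ (i, j))"
    and S: "S = mat 2 2 (\<lambda>(i, j). \<Sigma> $$ (i, j))"
    and V: "V = mat 2 n (\<lambda>(i, j). V' $$ (j, i))"
    using svd by (auto simp: truncated_svd_def dims)
  have U': "U' \<in> carrier_mat m m" "U'\<^sup>T * U' = 1\<^sub>m m" and V': "V' \<in> carrier_mat n n"
    and \<Sigma>: "\<Sigma> \<in> carrier_mat m n" "diagonal_mat \<Sigma>" and M': "M = U' * \<Sigma> * V'\<^sup>T"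
    using full by (auto simp: full_svd_def Let_def dims)
  show car: "U \<in> carrier_mat m 2" "S \<in> carrier_mat 2 2" "V \<in> carrier_mat 2 n"
    by (auto simp: U S V)
  show "U\<^sup>T * U = 1\<^sub>m 2"
  proof (rule eq_matI)
    fix i j :: nat
    assume ij: "i < dim_row (1\<^sub>m 2 :: real mat)" "j < dim_col (1\<^sub>m 2 :: real mat)"
    have "(U\<^sup>T * U) $$ (i, j) = (U'\<^sup>T * U') $$ (i, j)"
      using ij mn U'(1) by (auto simp: U scalar_prod_def)
    then show "(U\<^sup>T * U) $$ (i, j) = 1\<^sub>m 2 $$ (i, j)"
      using ij mn unfolding U'(2) by auto
  qed (use car in auto)
  have \<Sigma>0: "\<Sigma> $$ (k, l) = 0" if "k < m" "l < n" "k \<noteq> l \<or> 2 \<le> l" for k l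
    using that full_svd_rank_two[OF full M, of k] \<Sigma> by (cases "k = l") (auto simp: diagonal_mat_def)
  \<comment> \<open>Used twice, once for each of the two inner indices of
    \<open>U' * \<Sigma> * V'\<^sup>T\<close>.\<close>
  have trunc: "(\<Sum>k<N. f k) = (\<Sum>k<2. f k)" if "2 \<le> N" "\<And>k. 2 \<le> k \<Longrightarrow> k < N \<Longrightarrow> f k = 0"
    for N and f :: "nat \<Rightarrow> real"
    using that by (intro sum.mono_neutral_right) auto
  have inner: "(\<Sum>k<m. c k * \<Sigma> $$ (k, l)) = (\<Sum>k<2. c k * \<Sigma> $$ (k, l))" if "l < 2" for c l
    by (rule trunc) (use mn \<Sigma>0 that in simp_all)
  show "M = U * (S * V)"
  proof (rule eq_matI)
    fix i j
    assume "i < dim_row (U * (S * V))" "j < dim_col (U * (S * V))"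
    then have ij: "i < m" "j < n"
      using car by auto
    have "M $$ (i, j) = (\<Sum>l<n. (\<Sum>k<m. U' $$ (i, k) * \<Sigma> $$ (k, l)) * V' $$ (j, l))"
      using ij U' \<Sigma> V' unfolding M'
      by (simp add: scalar_prod_def atLeast0LessThan del: assoc_mult_mat)
    also have "\<dots> = (\<Sum>l<2. (\<Sum>k<m. U' $$ (i, k) * \<Sigma> $$ (k, l)) * V' $$ (j, l))"
      by (rule trunc) (use mn \<Sigma>0 in simp_all)
    also have "\<dots> = (\<Sum>l<2. (\<Sum>k<2. U' $$ (i, k) * \<Sigma> $$ (k, l)) * V' $$ (j, l))"
      by (intro sum.cong refl) (simp add: inner)
    also have "\<dots> = (U * S * V) $$ (i, j)"
      using ij by (simp add: U S V scalar_prod_def atLeast0LessThan del: assoc_mult_mat)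
    also have "U * S * V = U * (S * V)"
      using car by (intro assoc_mult_mat) auto
    finally show "M $$ (i, j) = (U * (S * V)) $$ (i, j)" .
  qed (use car dims in auto)
qed

section \<open>Successive projection in the plane\<close>

lemma l2_norm_col_sq:
  assumes "X \<in> carrier_mat 2 n" "j < n"
  shows "(l2_norm (col X j))\<^sup>2 = (X $$ (0, j))\<^sup>2 + (X $$ (1, j))\<^sup>2"
  using assms by (simp add: l2_norm_def scalar_prod_def numeral_2_eq_2)

lemma max_norm_colD:
  assumes "max_norm_col X k" "X \<in> carrier_mat 2 n"
  shows "k < n"
    and "j < n \<Longrightarrow> (X $$ (0, j))\<^sup>2 + (X $$ (1, j))\<^sup>2 \<le> (X $$ (0, k))\<^sup>2 + (X $$ (1, k))\<^sup>2"
proof -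
  show k: "k < n"
    using assms by (auto simp: max_norm_col_def is_arg_max_def)
  assume j: "j < n"
  then have "\<not> l2_norm (col X k) < l2_norm (col X j)"
    using assms by (auto simp: max_norm_col_def is_arg_max_def)
  then have "l2_norm (col X j) \<le> l2_norm (col X k)"
    by simp
  moreover have "0 \<le> l2_norm (col X j)"
    using assms j by (simp add: l2_norm_def scalar_prod_def numeral_2_eq_2)
  ultimately have "(l2_norm (col X j))\<^sup>2 \<le> (l2_norm (col X k))\<^sup>2"
    by (rule power_mono)
  then show "(X $$ (0, j))\<^sup>2 + (X $$ (1, j))\<^sup>2 \<le> (X $$ (0, k))\<^sup>2 + (X $$ (1, k))\<^sup>2"
    using l2_norm_col_sq[OF assms(2)] j k by simp
qed

text \<open>In the plane the component of a column orthogonal to x has length |det(x, column)| /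
  |x|. The second SPA step thus maximizes the absolute value of a determinant, which is linear in
  the column.\<close>

lemma spa_residual_norm_sq:
  assumes X: "X \<in> carrier_mat 2 n" and k: "k < n" and j: "j < n"
    and N: "N = (X $$ (0, k))\<^sup>2 + (X $$ (1, k))\<^sup>2" "N \<noteq> 0"
  shows "((spa_residual X k) $$ (0, j))\<^sup>2 + ((spa_residual X k) $$ (1, j))\<^sup>2
    = (X $$ (0, k) * X $$ (1, j) - X $$ (1, k) * X $$ (0, j))\<^sup>2 / N"
proof -
  define x0 x1 p q where "x0 = X $$ (0, k)" "x1 = X $$ (1, k)" "p = X $$ (0, j)" "q = X $$ (1, j)"
  note defs = this
  have nz: "col X k \<noteq> 0\<^sub>v 2"
  proof
    assume "col X k = 0\<^sub>v 2"
    then have "col X k $ 0 = 0" "col X k $ 1 = 0"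
      by auto
    then show False
      using N X k by auto
  qed
  have N': "(l2_norm (col X k))\<^sup>2 = N"
    using l2_norm_col_sq[OF X k] N by simp
  have Nx: "N = x0\<^sup>2 + x1\<^sup>2"
    using N by (simp add: defs)
  \<comment> \<open>With D = x0 q - x1 p, the two coordinates below say that the residual is D / N
    times (-x1, x0), the quarter turn of column \<open>k\<close>.\<close>
  have "(spa_residual X k) $$ (0, j) = (1 - x0 * x0 / N) * p - x0 * x1 / N * q"
    using X k j nz N'
    by (simp add: spa_residual_def Let_def defs scalar_prod_def numeral_2_eq_2 mat_of_cols_index
        mat_of_rows_index)
  also have "\<dots> = x1 * (x1 * p - x0 * q) / N"
    using N(2) by (simp add: field_simps) (simp add: Nx algebra_simps power2_eq_square)
  finally have r0: "(spa_residual X k) $$ (0, j) = x1 * (x1 * p - x0 * q) / N" .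
  have "(spa_residual X k) $$ (1, j) = - (x1 * x0 / N) * p + (1 - x1 * x1 / N) * q"
    using X k j nz N'
    by (simp add: spa_residual_def Let_def defs scalar_prod_def numeral_2_eq_2 mat_of_cols_index
        mat_of_rows_index)
  also have "\<dots> = x0 * (x0 * q - x1 * p) / N"
    using N(2) by (simp add: field_simps) (simp add: Nx algebra_simps power2_eq_square)
  finally have r1: "(spa_residual X k) $$ (1, j) = x0 * (x0 * q - x1 * p) / N" .
  have "(x1 * (x1 * p - x0 * q) / N)\<^sup>2 + (x0 * (x0 * q - x1 * p) / N)\<^sup>2
      = (x0\<^sup>2 + x1\<^sup>2) * (x0 * q - x1 * p)\<^sup>2 / N\<^sup>2"
    by (simp add: power_divide add_divide_distrib[symmetric])
      (simp add: power2_eq_square algebra_simps)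
  also have "\<dots> = (x0 * q - x1 * p)\<^sup>2 / N"
    using N(2) by (simp add: Nx[symmetric]) (simp add: power2_eq_square)
  finally show ?thesis
    unfolding r0 r1 by (simp add: defs)
qed

lemma spa_residual_carrier:
  "X \<in> carrier_mat 2 n \<Longrightarrow> spa_residual X k \<in> carrier_mat 2 n"
  by (auto simp: spa_residual_def Let_def)

text \<open>Strict convexity of the squared norm: a nonzero point of the triangle 0, a, b that is at
  least as long as a and b must be a vertex.\<close>

lemma max_norm_in_triangle:
  fixes p q a0 a1 b0 b1 f g :: real
  assumes f: "0 \<le> f" "0 \<le> g" "f + g \<le> 1"
    and pq: "p = f * a0 + g * b0" "q = f * a1 + g * b1"
    and N: "N = p\<^sup>2 + q\<^sup>2" "N \<noteq> 0"
    and a: "a0\<^sup>2 + a1\<^sup>2 \<le> N" and b: "b0\<^sup>2 + b1\<^sup>2 \<le> N"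
  shows "p = a0 \<and> q = a1 \<or> p = b0 \<and> q = b1"
proof -
  define d where "d = (a0 - b0)\<^sup>2 + (a1 - b1)\<^sup>2"
  have pos: "N > 0"
    using N by (smt (verit) zero_le_power2)
  \<comment> \<open>The identity |fa + gb|^2 = (f + g)(f|a|^2 + g|b|^2) - fg|a - b|^2 makes the
    convexity defect explicit. Bounding both norms by \<open>N\<close> leaves no slack, which forces
    f + g = 1 and fg|a - b|^2 = 0.\<close>
  have "N = f * (f + g) * (a0\<^sup>2 + a1\<^sup>2) + g * (f + g) * (b0\<^sup>2 + b1\<^sup>2) - f * g * d"
    unfolding N(1) pq d_def by (simp add: algebra_simps power2_eq_square)
  also have "\<dots> \<le> f * (f + g) * N + g * (f + g) * N - f * g * d"
    using f a b by (intro diff_mono add_mono mult_left_mono) auto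
  also have "\<dots> = (f + g)\<^sup>2 * N - f * g * d"
    by (simp add: algebra_simps power2_eq_square)
  finally have le: "N \<le> (f + g)\<^sup>2 * N - f * g * d" .
  have fgd: "0 \<le> f * g * d"
    using f by (simp add: d_def)
  have sq: "(f + g)\<^sup>2 \<le> 1"
    using f by (simp add: power_le_one)
  have "(f + g)\<^sup>2 * N \<le> 1 * N"
    using sq pos by (intro mult_right_mono) auto
  with le fgd have z: "f * g * d = 0" and "(f + g)\<^sup>2 * N = 1 * N"
    by linarith+
  then have "(f + g)\<^sup>2 = 1"
    using pos by simp
  then have fg: "f + g = 1"
    using f by (simp add: power2_eq_1_iff)
  from z consider "f = 0" | "g = 0" | "d = 0"
    by auto
  then show ?thesis
  proof cases
    case 3
    then have "a0 = b0" "a1 = b1"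
      by (auto simp: d_def sum_power2_eq_zero_iff)
    then show ?thesis
      using fg by (simp add: pq distrib_right[symmetric])
  qed (use fg pq in auto)
qed

text \<open>A vanishing determinant puts (p, q) on the line spanned by (x0, x1), so it equals its
  orthogonal projection onto that line. The coefficient is written as inner product over
  \<open>N\<close> so that its sign can be read off.\<close>

lemma two_dim_parallel:
  fixes x0 x1 p q :: real
  assumes "N = x0\<^sup>2 + x1\<^sup>2" "N \<noteq> 0" "x0 * q - x1 * p = 0"
  shows "p = (x0 * p + x1 * q) / N * x0" "q = (x0 * p + x1 * q) / N * x1"
proof -
  have e: "x0 * q = x1 * p"
    using assms(3) by simp
  have "p * N = (x0 * p + x1 * q) * x0" "q * N = (x0 * p + x1 * q) * x1"
    using e e[symmetric] by (simp_all add: assms(1) algebra_simps power2_eq_square)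
  then show "p = (x0 * p + x1 * q) / N * x0" "q = (x0 * p + x1 * q) / N * x1"
    using assms(2) by (simp_all add: field_simps)
qed

text \<open>The hypothesis \<open>gram\<close> serves the degenerate case where all columns are
  collinear: it excludes negative multiples of column \<open>k1\<close>. Otherwise \<open>k1\<close>
  and \<open>k2\<close> select the two generators themselves, and the hull coefficients already do
  the job.\<close>

lemma spa2_cone:
  assumes X: "X \<in> carrier_mat 2 n" and spa: "spa2 X k1 k2"
    and ab: "a < n" "b < n"
    and fg: "\<And>j. j < n \<Longrightarrow> 0 \<le> f j" "\<And>j. j < n \<Longrightarrow> 0 \<le> g j" "\<And>j. j < n \<Longrightarrow> f j + g j \<le> 1"
    and hull: "\<And>i j. i < 2 \<Longrightarrow> j < n \<Longrightarrow> X $$ (i, j) = f j * X $$ (i, a) + g j * X $$ (i, b)"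
    and gram: "\<And>j k. j < n \<Longrightarrow> k < n \<Longrightarrow> 0 \<le> X $$ (0, j) * X $$ (0, k) + X $$ (1, j) * X $$ (1, k)"
    and j: "j < n"
  shows "\<exists>y\<ge>0. \<exists>z\<ge>0. \<forall>i<2. X $$ (i, j) = y * X $$ (i, k1) + z * X $$ (i, k2)"
proof -
  have max1: "max_norm_col X k1" and max2: "max_norm_col (spa_residual X k1) k2"
    using spa by (auto simp: spa2_def)
  note k1 = max_norm_colD[OF max1 X] and k2 = max_norm_colD[OF max2 spa_residual_carrier[OF X]]
  have hull0: "X $$ (0, l) = f l * X $$ (0, a) + g l * X $$ (0, b)"
    and hull1: "X $$ (1, l) = f l * X $$ (1, a) + g l * X $$ (1, b)" if "l < n" for l
    using hull that by auto
  define N where "N = (X $$ (0, k1))\<^sup>2 + (X $$ (1, k1))\<^sup>2"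
  define D where "D l = X $$ (0, k1) * X $$ (1, l) - X $$ (1, k1) * X $$ (0, l)" for l
  show ?thesis
  proof (cases "N = 0")
    \<comment> \<open>The longest column is zero, hence so are all columns.\<close>
    case True
    then have "X $$ (0, j) = 0 \<and> X $$ (1, j) = 0"
      using k1(2)[OF j] by (simp add: N_def sum_power2_le_zero_iff)
    then have "\<forall>i<2. X $$ (i, j) = 0 * X $$ (i, k1) + 0 * X $$ (i, k2)"
      by (auto simp: less_2_cases_iff)
    then show ?thesis
      by blast
  next
    case N: False
    have pos: "N > 0"
      using N by (smt (verit) N_def zero_le_power2)
    have Dmax: "(D l)\<^sup>2 \<le> (D k2)\<^sup>2" if "l < n" for l
      using k2(2)[OF that] spa_residual_norm_sq[OF X k1(1) _ N_def N] that k2(1) pos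
      by (simp add: D_def divide_le_cancel)
    have vertex: "X $$ (0, k1) = X $$ (0, a) \<and> X $$ (1, k1) = X $$ (1, a)
        \<or> X $$ (0, k1) = X $$ (0, b) \<and> X $$ (1, k1) = X $$ (1, b)"
      using fg[OF k1(1)] k1(2)[OF ab(1)] k1(2)[OF ab(2)]
      by (intro max_norm_in_triangle[OF _ _ _ hull0[OF k1(1)] hull1[OF k1(1)] N_def N])
        (simp_all add: N_def)
    text \<open>By symmetry of the hull, \<open>k1\<close> may be taken to be \<open>c\<close>, with \<open>d\<close> the other generator.\<close>
    have *: ?thesis
      if cd: "c < n" "d < n" "X $$ (0, k1) = X $$ (0, c)" "X $$ (1, k1) = X $$ (1, c)"
        and uv: "\<And>l. l < n \<Longrightarrow> 0 \<le> u l" "\<And>l. l < n \<Longrightarrow> 0 \<le> v l" "\<And>l. l < n \<Longrightarrow> u l + v l \<le> 1"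
        and h0: "\<And>l. l < n \<Longrightarrow> X $$ (0, l) = u l * X $$ (0, c) + v l * X $$ (0, d)"
        and h1: "\<And>l. l < n \<Longrightarrow> X $$ (1, l) = u l * X $$ (1, c) + v l * X $$ (1, d)"
      for c d u v
    proof -
      \<comment> \<open>The determinant is linear in the column and vanishes on \<open>c\<close>,
        which coincides with column \<open>k1\<close>; only the \<open>d\<close> part
        survives.\<close>
      have Dv: "D l = v l * D d" if "l < n" for l
        unfolding D_def h0[OF that] h1[OF that] cd(3,4) by (simp add: algebra_simps)
      show ?thesis
      proof (cases "D d = 0")
        case True
        then have "D j = 0"
          using Dv[OF j] by simp
        note par = two_dim_parallel[OF N_def N this[unfolded D_def]]
        let ?c = "(X $$ (0, k1) * X $$ (0, j) + X $$ (1, k1) * X $$ (1, j)) / N"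
        \<comment> \<open>All residuals are zero here, so \<open>k2\<close> is arbitrary and gets
          weight 0.\<close>
        have "\<forall>i<2. X $$ (i, j) = ?c * X $$ (i, k1) + 0 * X $$ (i, k2)"
          using par by (auto simp: less_2_cases_iff)
        moreover have "0 \<le> ?c"
          using gram[OF k1(1) j] pos by simp
        ultimately show ?thesis
          by blast
      next
        case False
        \<comment> \<open>Column \<open>d\<close> competes in the second SPA step, so maximality of
          \<open>k2\<close> bounds \<open>v k2\<close> below by 1, while the hull bounds it above by
          1.\<close>
        have "(D d)\<^sup>2 \<le> (v k2)\<^sup>2 * (D d)\<^sup>2"
          using Dmax[OF cd(2)] Dv[OF k2(1)] by (simp add: power_mult_distrib)
        then have "1 \<le> (v k2)\<^sup>2"
          using False by (simp add: mult_le_cancel_right1)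
        then have "1 \<le> v k2"
          using uv(2)[OF k2(1)] by (smt (verit) power_le_one_iff power2_le_imp_le one_power2)
        then have "v k2 = 1" "u k2 = 0"
          using uv[OF k2(1)] by auto
        then have "X $$ (0, k2) = X $$ (0, d)" "X $$ (1, k2) = X $$ (1, d)"
          using h0[OF k2(1)] h1[OF k2(1)] by auto
        then have "\<forall>i<2. X $$ (i, j) = u j * X $$ (i, k1) + v j * X $$ (i, k2)"
          using h0[OF j] h1[OF j] cd by (auto simp: less_2_cases_iff)
        then show ?thesis
          using uv[OF j] by blast
      qed
    qed
    from vertex show ?thesis
    proof
      assume "X $$ (0, k1) = X $$ (0, a) \<and> X $$ (1, k1) = X $$ (1, a)"
      then show ?thesis
        using *[of a b f g] ab fg hull0 hull1 by blast
    next
      assume "X $$ (0, k1) = X $$ (0, b) \<and> X $$ (1, k1) = X $$ (1, b)"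
      then show ?thesis
      proof (intro *[of b a g f])
        fix l
        assume l: "l < n"
        show "g l + f l \<le> 1"
          using fg(3)[OF l] by simp
        show "X $$ (0, l) = g l * X $$ (0, b) + f l * X $$ (0, a)"
          using hull0[OF l] by simp
        show "X $$ (1, l) = g l * X $$ (1, b) + f l * X $$ (1, a)"
          using hull1[OF l] by simp
      qed (use ab fg in simp_all)
    qed
  qed
qed

section \<open>Optimality of the algorithm\<close>

lemma nonneg_matsD:
  assumes "A \<in> nonneg_mats m n"
  shows "A \<in> carrier_mat m n" "i < m \<Longrightarrow> j < n \<Longrightarrow> 0 \<le> A $$ (i, j)"
proof -
  have A: "A \<in> carrier_mat m n" and le: "0\<^sub>m m n \<le> A"
    using assms by (auto simp: nonneg_mats_def)
  show "A \<in> carrier_mat m n"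
    by (rule A)
  show "0 \<le> A $$ (i, j)" if "i < m" "j < n"
    using A le that unfolding less_eq_mat_def by (metis carrier_matD index_zero_mat(1))
qed

lemma frob_norm_zero [simp]: "frob_norm (0\<^sub>m m n) = 0"
  by (simp add: frob_norm_def)

text \<open>Here \<open>F\<close> is the coefficient matrix with the permutation absorbed, and
  \<open>a\<close>, \<open>b\<close> are the positions of the pure pixels. The output is optimal
  because an exact nonnegative factorization with left factor \<open>W\<close> exists, so the
  least-squares step reaches residual zero.\<close>

lemma rank_two_nmf_optimal:
  assumes mn: "2 \<le> m" "2 \<le> n"
    and M: "M \<in> nonneg_mats m n" "M = A * F"
    and A: "A \<in> carrier_mat m 2" and F: "F \<in> nonneg_mats 2 n"
    and sum_le: "\<And>j. j < n \<Longrightarrow> F $$ (0, j) + F $$ (1, j) \<le> 1"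
    and ab: "a < n" "b < n" "F $$ (0, a) = 1" "F $$ (1, a) = 0" "F $$ (0, b) = 0" "F $$ (1, b) = 1"
    and alg: "rank_two_nmf M W H"
  shows "is_arg_min (\<lambda>(P, Q). (frob_norm (M - P * Q))\<^sup>2)
           (\<lambda>(P, Q). P \<in> nonneg_mats m 2 \<and> Q \<in> nonneg_mats 2 n) (W, H)"
proof -
  note Mc = nonneg_matsD(1)[OF M(1)] and Fc = nonneg_matsD(1)[OF F]
  obtain U S V k1 k2 where svd: "truncated_svd 2 M U S V" and spa: "spa2 (S * V) k1 k2"
    and W: "W = map_mat (max 0) (U * S * mat_of_cols 2 [col V k1, col V k2])"
    and H: "is_arg_min (\<lambda>Y. (frob_norm (M - W * Y))\<^sup>2) (\<lambda>Y. Y \<in> nonneg_mats 2 n) H"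
    using alg Mc by (auto simp: rank_two_nmf_def)
  note svd = truncated_svd_exact[OF svd M(2) A Fc mn]
  define X where "X = S * V"
  have X: "X \<in> carrier_mat 2 n"
    using svd by (simp add: X_def)
  have MX: "M = U * X"
    using svd by (simp add: X_def)
  have "U\<^sup>T * M = (U\<^sup>T * U) * X"
    unfolding MX using svd X by (intro assoc_mult_mat[symmetric]) auto
  then have XM: "X = U\<^sup>T * M"
    using svd X by (simp add: left_mult_one_mat[of _ 2 n])
  have Ment: "M $$ (i, j) = U $$ (i, 0) * X $$ (0, j) + U $$ (i, 1) * X $$ (1, j)"
    if "i < m" "j < n" for i j
    unfolding MX using that svd X by (simp add: scalar_prod_def numeral_2_eq_2)
  have Mhull: "M $$ (i, j) = F $$ (0, j) * M $$ (i, a) + F $$ (1, j) * M $$ (i, b)"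
    if "i < m" "j < n" for i j
    unfolding M(2) using that A Fc ab by (simp add: scalar_prod_def numeral_2_eq_2)
  have Xent: "X $$ (i, j) = (\<Sum>k<m. U $$ (k, i) * M $$ (k, j))" if "i < 2" "j < n" for i j
    unfolding XM using that svd Mc by (simp add: scalar_prod_def atLeast0LessThan)
  \<comment> \<open>The hull relation holds for the columns of \<open>M\<close> and passes to
    \<open>X\<close> through the linear map \<open>U\<^sup>T\<close>.\<close>
  have Xhull: "X $$ (i, j) = F $$ (0, j) * X $$ (i, a) + F $$ (1, j) * X $$ (i, b)"
    if "i < 2" "j < n" for i j
    using that ab by (simp add: Xent sum_distrib_left sum.distrib[symmetric])
      (intro sum.cong refl, simp add: Mhull[of _ j] algebra_simps)
  have gram: "0 \<le> X $$ (0, j) * X $$ (0, k) + X $$ (1, j) * X $$ (1, k)" if "j < n" "k < n" for j k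
  proof -
    \<comment> \<open>Inner products of columns agree for \<open>X\<close> and \<open>M\<close>:
      expand one factor by \<open>X = U\<^sup>T * M\<close> and recombine the other by
      \<open>M = U * X\<close>.\<close>
    have "X $$ (0, j) * X $$ (0, k) + X $$ (1, j) * X $$ (1, k) = (\<Sum>i<m. M $$ (i, j) * M $$ (i, k))"
      using that by (simp add: Xent[of _ k] sum_distrib_left sum.distrib[symmetric])
        (intro sum.cong refl, simp add: Ment[of _ j] algebra_simps)
    also have "\<dots> \<ge> 0"
      using that nonneg_matsD(2)[OF M(1)] by (intro sum_nonneg mult_nonneg_nonneg) auto
    finally show ?thesis .
  qed
  have "\<exists>y\<ge>0. \<exists>z\<ge>0. \<forall>i<2. X $$ (i, j) = y * X $$ (i, k1) + z * X $$ (i, k2)" if "j < n" for j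
    by (rule spa2_cone[OF X spa[folded X_def] ab(1,2) _ _ sum_le Xhull gram that])
      (simp_all add: nonneg_matsD(2)[OF F])
  then obtain y z where yz: "\<And>j. j < n \<Longrightarrow> 0 \<le> y j \<and> 0 \<le> z j \<and>
      (\<forall>i<2. X $$ (i, j) = y j * X $$ (i, k1) + z j * X $$ (i, k2))"
    by metis
  have k: "k1 < n" "k2 < n"
    using spa X max_norm_colD(1)[OF _ X] max_norm_colD(1)[OF _ spa_residual_carrier[OF X]]
    by (auto simp: spa2_def X_def)
  have Wc: "W \<in> carrier_mat m 2"
    using svd by (auto simp: W)
  \<comment> \<open>Before thresholding, the matrix consists of columns \<open>k1\<close> and
    \<open>k2\<close> of \<open>M\<close>, since \<open>U * S * V = M\<close>. These are
    nonnegative, so \<open>max 0\<close> changes nothing.\<close>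
  have went: "(U * S * mat_of_cols 2 [col V k1, col V k2]) $$ (i, l) = M $$ (i, if l = 0 then k1 else k2)"
    if "i < m" "l < 2" for i l
  proof -
    have "col (mat_of_cols 2 [col V k1, col V k2]) l = col V (if l = 0 then k1 else k2)"
      using svd(3) that(2) by (subst col_mat_of_cols) (auto simp: less_2_cases_iff intro: carrier_vecI)
    then have "(U * S * mat_of_cols 2 [col V k1, col V k2]) $$ (i, l)
        = (U * S * V) $$ (i, if l = 0 then k1 else k2)"
      using svd(1-3) that k by (simp del: assoc_mult_mat)
    also have "U * S * V = M"
      using svd by (simp add: assoc_mult_mat[of _ m 2 _ 2 _ n])
    finally show ?thesis .
  qed
  have Went: "W $$ (i, 0) = M $$ (i, k1)" "W $$ (i, 1) = M $$ (i, k2)" if "i < m" for i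
    using went[OF that, of 0] went[OF that, of 1] svd(1) that nonneg_matsD(2)[OF M(1) that] k
    by (simp_all add: W del: index_mult_mat(1))
  have Wn: "W \<in> nonneg_mats m 2"
    using Wc Went nonneg_matsD(2)[OF M(1)] k
    by (auto simp: nonneg_mats_def less_eq_mat_def less_2_cases_iff)
  \<comment> \<open>The cone coefficients found for \<open>X\<close> also express the columns of
    \<open>M\<close>, after applying \<open>U\<close>.\<close>
  define Y where "Y = mat 2 n (\<lambda>(i, j). if i = 0 then y j else z j)"
  have Y: "Y \<in> nonneg_mats 2 n"
    using yz by (auto simp: nonneg_mats_def less_eq_mat_def Y_def)
  have "M = W * Y"
  proof (rule eq_matI)
    fix i j
    assume "i < dim_row (W * Y)" "j < dim_col (W * Y)"
    then have ij: "i < m" "j < n"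
      using Wc by (auto simp: Y_def)
    have "(W * Y) $$ (i, j) = W $$ (i, 0) * y j + W $$ (i, 1) * z j"
      using ij Wc by (simp add: Y_def scalar_prod_def numeral_2_eq_2)
    also have "\<dots> = M $$ (i, j)"
      using ij k yz[OF ij(2)] by (simp add: Went[OF ij(1), unfolded One_nat_def] Ment algebra_simps)
    finally show "M $$ (i, j) = (W * Y) $$ (i, j)" by simp
  qed (use Wc Mc in \<open>auto simp: Y_def\<close>)
  then have "(frob_norm (M - W * Y))\<^sup>2 = 0"
    using Mc by (simp add: minus_r_inv_mat[of _ m n])
  then have "(frob_norm (M - W * H))\<^sup>2 \<le> 0"
    using H Y by (auto simp: is_arg_min_def not_less)
  moreover have "H \<in> nonneg_mats 2 n"
    using H by (simp add: is_arg_min_def)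
  ultimately show ?thesis
    using Wn by (auto simp: is_arg_min_def not_less intro: order_trans)
qed

theorem corollary2:
  fixes m n :: nat and M Wt H' Perm W H :: "real mat"
  assumes "m \<ge> 2" and "n \<ge> 2"
    and "M \<in> nonneg_mats m n"
    and "Wt \<in> nonneg_mats m 2"
    and "H' \<in> nonneg_mats 2 (n - 2)"
    and "\<forall>j<n - 2. (\<Sum>i<2. H' $$ (i, j)) \<le> 1"
    and "permutation_mat n Perm"
    and "M = Wt * (1\<^sub>m 2 @\<^sub>c H') * Perm"
    and "rank_two_nmf M W H"
  shows "is_arg_min (\<lambda>(P, Q). (frob_norm (M - P * Q))\<^sup>2)
           (\<lambda>(P, Q). P \<in> nonneg_mats m 2 \<and> Q \<in> nonneg_mats 2 n) (W, H)"
proof -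
  obtain \<pi> where \<pi>: "\<pi> permutes {..<n}" and P: "Perm = mat n n (\<lambda>(i, j). if i = \<pi> j then 1 else 0)"
    using assms(7) by (auto simp: permutation_mat_def)
  define G where "G = 1\<^sub>m 2 @\<^sub>c H'"
  note H' = nonneg_matsD[OF assms(5)] and Wt = nonneg_matsD(1)[OF assms(4)]
  have Gc: "G \<in> carrier_mat 2 n"
    using H'(1) assms(2) by (auto simp: G_def append_cols_def)
  have G: "G $$ (i, j) = (if j < 2 then if i = j then 1 else 0 else H' $$ (i, j - 2))"
    if "i < 2" "j < n" for i j
    using that H'(1) by (auto simp: G_def append_cols_def)
  have Gnn: "0 \<le> G $$ (i, j)" if "i < 2" "j < n" for i j
    using that H'(2)[of i "j - 2"] by (auto simp: G)
  have Gsum: "G $$ (0, j) + G $$ (1, j) \<le> 1" if "j < n" for j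
  proof (cases "j < 2")
    case True
    then show ?thesis
      using that by (auto simp: G less_2_cases_iff)
  next
    case False
    then have "j - 2 < n - 2"
      using that by simp
    then show ?thesis
      using assms(6) that False by (auto simp: G numeral_2_eq_2)
  qed
  have \<pi>n: "\<pi> j < n" if "j < n" for j
    using permutes_in_image[OF \<pi>, of j] that by simp
  have Pc: "Perm \<in> carrier_mat n n"
    by (simp add: P)
  \<comment> \<open>Column \<open>j\<close> of \<open>Perm\<close> has its 1 in row
    \<open>\<pi> j\<close>, so right multiplication moves column \<open>\<pi> j\<close> of
    \<open>G\<close> to position \<open>j\<close>.\<close>
  have F: "(G * Perm) $$ (i, j) = G $$ (i, \<pi> j)" if "i < 2" "j < n" for i j
    using that Gc \<pi>n[OF that(2)]
    by (simp add: P scalar_prod_def if_distrib[of "(*) _"] sum.delta cong: if_cong)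
  have Fn: "G * Perm \<in> nonneg_mats 2 n"
    using Gc Pc Gnn \<pi>n F by (auto simp: nonneg_mats_def less_eq_mat_def simp del: index_mult_mat(1))
  have pre: "\<exists>a<n. \<pi> a = l" if "l < n" for l
    using that permutes_surj[OF \<pi>] permutes_in_image[OF \<pi>] by (metis lessThan_iff surjD)
  \<comment> \<open>The preimages of 0 and 1 are where the identity block, that is the pure pixels,
    ends up.\<close>
  obtain a b where ab: "a < n" "\<pi> a = 0" "b < n" "\<pi> b = 1"
    using pre[of 0] pre[of 1] assms(2) by auto
  have M: "M = Wt * (G * Perm)"
    using assms(8) Wt Gc Pc by (simp add: G_def[symmetric] assoc_mult_mat[of _ m 2 _ n _ n])
  show ?thesis
  proof (rule rank_two_nmf_optimal[OF assms(1-3) M Wt Fn _ ab(1,3) _ _ _ _ assms(9)])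
    show "(G * Perm) $$ (0, j) + (G * Perm) $$ (1, j) \<le> 1" if "j < n" for j
      using F[of 0 j] F[of 1 j] Gsum[OF \<pi>n] that by simp
    show "(G * Perm) $$ (0, a) = 1" "(G * Perm) $$ (1, a) = 0"
      using F[of 0 a] F[of 1 a] ab G assms(2) by simp_all
    show "(G * Perm) $$ (0, b) = 0" "(G * Perm) $$ (1, b) = 1"
      using F[of 0 b] F[of 1 b] ab G assms(2) by simp_all
  qed
qed

end
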